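(* Let $m,n,r$ be positive integers. For $n>e^m$, $$D_{m,r}(n)=\frac{e^{g_0}}{\sqrt{4\pi g_2}}\cdot\frac{n!}{\delta^n}\left(1+O\!\left(\frac{(\log n)^{12}}{\sqrt n}\right)\right),$$ where $\delta$ is a positive real number such that $\delta\,(r+e^{m\delta})=n$, $$g_0=r\delta+\frac{e^{m\delta}-1}{m},\qquad g_2=\frac{n+m\delta^2e^{m\delta}}{2},$$ and the implied constant is absolute (i.e. independent of $m$, $n$, $r$).
   Context: For positive integers $m,r$, the $r$-Whitney numbers of the second kind $W_{m,r}(n,k)$ ($0\le k\le n$) are defined by the polynomial identity in $x$ $$(mx+r)^n=\sum_{k=0}^{n}m^k\,W_{m,r}(n,k)\,(x)_k,\qquad (x)_k=x(x-1)\cdots(x-k+1),$$ and the $r$-Dowling numbers are $$D_{m,r}(n)=\sum_{k=0}^{n}W_{m,r}(n,k).$$ *)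

theory Defs
  imports Complex_Main "HOL-Computational_Algebra.Polynomial"
begin

definition falling_poly :: "nat \<Rightarrow> real poly" where
  "falling_poly k = (\<Prod>i<k. [:- real i, 1:])"

text \<open>
  The coefficients are extended by zero beyond \<open>k = n\<close>, so that the polynomial identity
  determines the whole sequence (see \<open>r_whitney_ex1\<close>).
\<close>
definition is_r_whitney :: "nat \<Rightarrow> nat \<Rightarrow> nat \<Rightarrow> (nat \<Rightarrow> real) \<Rightarrow> bool" where
  "is_r_whitney m r n w \<longleftrightarrow> (\<forall>k>n. w k = 0) \<and>
     [:real r, real m:] ^ n = (\<Sum>k\<le>n. smult (real m ^ k * w k) (falling_poly k))"

definition r_whitney :: "nat \<Rightarrow> nat \<Rightarrow> nat \<Rightarrow> nat \<Rightarrow> real" where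
  "r_whitney m r n = (THE w. is_r_whitney m r n w)"

definition r_dowling :: "nat \<Rightarrow> nat \<Rightarrow> nat \<Rightarrow> real" where
  "r_dowling m r n = (\<Sum>k\<le>n. r_whitney m r n k)"

lemma falling_poly_Suc: "falling_poly (Suc k) = falling_poly k * [:- real k, 1:]"
  by (simp only: falling_poly_def prod.lessThan_Suc)

lemma monic_falling_poly: "degree (falling_poly k) = k \<and> coeff (falling_poly k) k = 1"
proof (induction k)
  case 0
  then show ?case by (simp add: falling_poly_def)
next
  case (Suc k)
  have nz: "falling_poly k \<noteq> 0" using Suc by (metis coeff_0 zero_neq_one)
  have "degree (falling_poly (Suc k)) = Suc k"
    unfolding falling_poly_Suc using nz Suc by (subst degree_mult_eq) auto
  moreover have "lead_coeff (falling_poly (Suc k)) = 1"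
    unfolding falling_poly_Suc using Suc by (simp add: lead_coeff_mult del: mult_pCons_right)
  ultimately show ?case by simp
qed

lemma falling_expansion_ex:
  "degree p \<le> n \<Longrightarrow> \<exists>c. p = (\<Sum>k\<le>n. smult (c k) (falling_poly k))"
proof (induction n arbitrary: p)
  case 0
  then show ?case
    by (intro exI[of _ "\<lambda>_. coeff p 0"]) (auto simp: falling_poly_def elim: degree_eq_zeroE)
next
  case (Suc n)
  let ?q = "p - smult (coeff p (Suc n)) (falling_poly (Suc n))"
  have "degree ?q \<le> n"
  proof (rule degree_le, intro allI impI)
    fix i assume "n < i"
    then show "coeff ?q i = 0"
      using Suc.prems monic_falling_poly[of "Suc n"]
      by (cases "i = Suc n") (auto simp: coeff_eq_0)
  qed
  from Suc.IH[OF this] obtain c where c: "?q = (\<Sum>k\<le>n. smult (c k) (falling_poly k))" ..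
  have "p = (\<Sum>k\<le>Suc n. smult ((c(Suc n := coeff p (Suc n))) k) (falling_poly k))"
    using c by (simp add: algebra_simps)
  then show ?case by blast
qed

lemma falling_expansion_unique:
  "(\<Sum>k\<le>n. smult (c k) (falling_poly k)) = 0 \<Longrightarrow> k \<le> n \<Longrightarrow> c k = 0"
proof (induction n arbitrary: k)
  case 0
  then show ?case by (simp add: falling_poly_def)
next
  case (Suc n)
  have "coeff (\<Sum>k\<le>Suc n. smult (c k) (falling_poly k)) (Suc n) = c (Suc n)"
    using monic_falling_poly by (simp add: coeff_sum coeff_eq_0)
  then have top: "c (Suc n) = 0" unfolding Suc.prems(1) by simp
  then show ?case
    using Suc.IH Suc.prems by (cases "k = Suc n") auto
qed

lemma r_whitney_ex1:
  assumes "m > 0"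
  shows "\<exists>!w. is_r_whitney m r n w"
proof -
  have "degree ([:real r, real m:] ^ n) \<le> n"
    using degree_power_le[of "[:real r, real m:]" n] assms by simp
  from falling_expansion_ex[OF this] obtain c
    where c: "[:real r, real m:] ^ n = (\<Sum>k\<le>n. smult (c k) (falling_poly k))" ..
  have "is_r_whitney m r n (\<lambda>k. if k \<le> n then c k / real m ^ k else 0)"
    using c assms by (auto simp: is_r_whitney_def intro!: sum.cong)
  moreover have "v = w" if v: "is_r_whitney m r n v" and w: "is_r_whitney m r n w" for v w
  proof
    fix k
    have "(\<Sum>k\<le>n. smult (real m ^ k * v k - real m ^ k * w k) (falling_poly k)) = 0"
      using v w by (simp add: is_r_whitney_def smult_diff_left sum_subtractf)
    from falling_expansion_unique[OF this] show "v k = w k"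
      using v w assms by (cases "k \<le> n") (auto simp: is_r_whitney_def)
  qed
  ultimately show ?thesis by blast
qed

lemma r_whitney_identity:
  assumes "m > 0"
  shows "[:real r, real m:] ^ n =
    (\<Sum>k\<le>n. smult (real m ^ k * r_whitney m r n k) (falling_poly k))"
  using theI'[OF r_whitney_ex1[OF assms, of r n]]
  by (simp add: r_whitney_def is_r_whitney_def)

lemma saddle_point_ex1:
  fixes m r n :: nat
  assumes "n > 0"
  shows "\<exists>!\<delta>::real. \<delta> > 0 \<and> \<delta> * (real r + exp (real m * \<delta>)) = real n"
proof -
  let ?f = "\<lambda>d::real. d * (real r + exp (real m * d))"
  have lt: "?f a < ?f b" if "0 < a" "a < b" for a b
  proof -
    have "real r + exp (real m * a) \<le> real r + exp (real m * b)"
      using that by (simp add: mult_left_mono)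
    moreover have "0 < real r + exp (real m * a)" by (simp add: add_nonneg_pos)
    ultimately show ?thesis using that by (intro mult_less_le_imp_less) auto
  qed
  have "?f (real n) \<ge> real n * 1"
  proof (rule mult_left_mono)
    show "1 \<le> real r + exp (real m * real n)"
      using one_le_exp_iff[of "real m * real n"] by (smt (verit) of_nat_0_le_iff mult_nonneg_nonneg)
  qed simp
  then obtain d where "0 \<le> d" "?f d = real n"
    using IVT'[of ?f 0 "real n" "real n"] by (force intro!: continuous_intros)
  then have "d > 0 \<and> ?f d = real n" using assms by (cases "d = 0") auto
  then show ?thesis
    using lt by (metis linorder_neqE_linordered_idom order_less_irrefl)
qed

end

theory Submission
  imports Defs "HOL-Probability.Distributions"
begin

text \<open>
  This is a saddle-point estimate. Expanding \<open>(m j + r)\<^sup>n\<close> in falling factorials of \<open>j\<close> and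
  averaging over a Poisson distribution with mean \<open>1/m\<close> gives a Dobinski formula for the
  \<open>r\<close>-Dowling numbers (\<open>r_dowling_dobinski\<close>). It says that \<open>D(n) / n!\<close> is the \<open>n\<close>-th Taylor
  coefficient of \<open>exp (r z + (exp (m z) - 1) / m)\<close>, so it is an integral over the
  circle \<open>\<bar>z\<bar> = \<delta>\<close> (\<open>r_dowling_circle_integral\<close>). After the value \<open>exp g0\<close> at angle \<open>t = 0\<close> is divided
  out, the integrand is \<open>exp (\<phi> t)\<close> for a phase \<open>\<phi>\<close> with \<open>\<phi> 0 = 0\<close>. The equation for \<open>\<delta>\<close> says
  exactly that \<open>\<phi>' 0 = 0\<close>, and \<open>\<phi>'' 0 = - s\<close> with \<open>s = 2 g2\<close>. Hence \<open>exp (\<phi> t)\<close> resembles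
  \<open>exp (- s t\<^sup>2 / 2)\<close>, whose integral \<open>sqrt (2 \<pi> / s)\<close> is the main term.

  No splitting into a central arc and tails is needed, because the modulus of the integrand has a
  Gaussian bound on the whole circle: with \<open>x = m \<delta>\<close>, \<open>Re (\<phi> t) \<le> - c t\<^sup>2\<close> for
  \<open>c = n / (8 (1 + 2 x))\<close> (\<open>Re_phase_le\<close>). The phase differs from \<open>- s t\<^sup>2 / 2\<close> by at most
  \<open>K \<bar>t\<bar>\<^sup>3\<close>, where \<open>K\<close> is \<open>n\<close> times a quadratic polynomial in \<open>x\<close> (\<open>phase_taylor\<close>). So the
  two integrands differ by at most \<open>K \<bar>t\<bar>\<^sup>3 exp (- c t\<^sup>2)\<close>, whose integral over the line is
  \<open>K / c\<^sup>2\<close>; this is a polynomial of degree four in \<open>x\<close> divided by \<open>n\<close> (\<open>phase_integral\<close>).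

  The hypothesis \<open>n > exp m\<close> gives \<open>x \<le> ln n\<close> (\<open>saddle_point_le_ln\<close>) and \<open>ln n \<ge> 1\<close>, so that
  every polynomial in \<open>x\<close> is bounded by a power of \<open>ln n\<close>. Since
  \<open>s \<le> n (1 + x)\<close>, dividing by the main term costs a factor of order at most \<open>sqrt n \<sqdot> ln n\<close>. The
  relative error is therefore \<open>O((ln n)\<^sup>5 / sqrt n)\<close>, with a constant that depends on
  none of the parameters.
\<close>

section \<open>Fourier coefficients\<close>

lemma set_integral_sums_dominated:
  fixes g :: "nat \<Rightarrow> real \<Rightarrow> complex"
  assumes cont: "\<And>k. continuous_on {a..b} (g k)"
    and bound: "\<And>k t. t \<in> {a..b} \<Longrightarrow> norm (g k t) \<le> B k"
    and summable: "summable B"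
    and sums: "\<And>t. t \<in> {a..b} \<Longrightarrow> (\<lambda>k. g k t) sums G t"
    and "a \<le> b"
  shows "(\<lambda>k. LINT t:{a..b}|lborel. g k t) sums (LINT t:{a..b}|lborel. G t)"
proof -
  let ?f = "\<lambda>k t. indicator {a..b} t *\<^sub>R g k t"
  have nb: "norm (?f k t) \<le> indicator {a..b} t * B k" for k t
    using bound[of t k] by (auto split: split_indicator)
  have int: "integrable lborel (?f k)" for k
    by (intro borel_integrable_compact compact_Icc cont)
  have ind: "integrable lborel (indicat_real {a..b})"
    by (rule integrable_real_indicator) (use \<open>a \<le> b\<close> in auto)
  have "(\<lambda>k. integral\<^sup>L lborel (?f k)) sums (\<integral>t. (\<Sum>k. ?f k t) \<partial>lborel)"
  proof (rule sums_integral)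
    show "AE t in lborel. summable (\<lambda>k. norm (?f k t))"
    proof (rule AE_I2)
      fix t
      have "summable (\<lambda>k. indicator {a..b} t * B k)" using summable by (rule summable_mult)
      then show "summable (\<lambda>k. norm (?f k t))"
        by (rule summable_comparison_test'[where N = 0]) (use nb in auto)
    qed
    have "norm (\<integral>t. norm (?f k t) \<partial>lborel) \<le> (b - a) * B k" for k
    proof -
      have "(\<integral>t. norm (?f k t) \<partial>lborel) \<le> (\<integral>t. indicator {a..b} t * B k \<partial>lborel)"
        by (intro integral_mono integrable_norm int nb integrable_mult_left ind)
      also have "\<dots> = (b - a) * B k"
        using \<open>a \<le> b\<close> by (subst integral_mult_left_zero) simp
      finally show ?thesis by simp
    qed
    then show "summable (\<lambda>k. \<integral>t. norm (?f k t) \<partial>lborel)"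
      by (intro summable_comparison_test'[where N = 0, OF summable_mult[OF summable]])
  qed (rule int)
  moreover have "(\<Sum>k. ?f k t) = indicator {a..b} t *\<^sub>R G t" for t
    using sums_unique[OF sums, of t] by (auto split: split_indicator)
  ultimately show ?thesis by (simp add: set_lebesgue_integral_def)
qed

lemma integral_cis_period:
  fixes k :: int
  shows "(LINT t:{-pi..pi}|lborel. cis (of_int k * t)) = (if k = 0 then 2 * of_real pi else 0)"
proof (cases "k = 0")
  case True
  then show ?thesis by (simp add: set_lebesgue_integral_def scaleR_conv_of_real)
next
  case False
  let ?F = "\<lambda>t::real. cis (of_int k * t) / (\<i> * of_int k)"
  have "(LINT t:{-pi..pi}|lborel. cis (of_int k * t)) = ?F pi - ?F (- pi)"
    unfolding set_lebesgue_integral_def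
  proof (rule integral_FTC_atLeastAtMost)
    fix t
    have "((\<lambda>t. cis (of_int k * t)) has_vector_derivative (of_int k * (\<i> * cis (of_int k * t)))) (at t within {-pi..pi})"
      unfolding cis_conv_exp has_vector_derivative_complex_iff
      by (auto intro!: derivative_eq_intros simp: Re_exp Im_exp)
    then have "((\<lambda>t. inverse (\<i> * of_int k) * cis (of_int k * t)) has_vector_derivative
       (inverse (\<i> * of_int k) * (of_int k * (\<i> * cis (of_int k * t))))) (at t within {-pi..pi})"
      by (rule has_vector_derivative_mult_right)
    with False show "(?F has_vector_derivative cis (of_int k * t)) (at t within {-pi..pi})"
      by (simp add: field_simps)
  qed (auto intro!: continuous_intros simp: cis_conv_exp)
  also have "cis (of_int k * pi) = cis (of_int k * (- pi))"
    using sin_npi_int[of k] by (simp add: complex_eq_iff mult.commute)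
  finally show ?thesis using False by simp
qed

text \<open>
  This is Cauchy's formula for the Taylor coefficients of \<open>exp (a z)\<close> on the unit circle. It
  follows by integrating the exponential series term by term, since only the term of
  order \<open>n\<close> survives.
\<close>

lemma exp_fourier_coefficient:
  fixes a :: real
  shows "(LINT t:{-pi..pi}|lborel. exp (of_real a * cis t) * cis (- (real n * t)))
    = of_real (2 * pi * a ^ n / fact n)"
proof -
  let ?g = "\<lambda>k t. of_real (a ^ k / fact k) * cis (of_int (int k - int n) * t)"
  have "(\<lambda>k. LINT t:{-pi..pi}|lborel. ?g k t) sums
      (LINT t:{-pi..pi}|lborel. exp (of_real a * cis t) * cis (- (real n * t)))"
  proof (rule set_integral_sums_dominated)
    show "summable (\<lambda>k. \<bar>a\<bar> ^ k / fact k)"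
      using summable_exp[of "\<bar>a\<bar>"] by (simp add: field_simps)
    show "norm (?g k t) \<le> \<bar>a\<bar> ^ k / fact k" for k t
      by (simp add: norm_mult power_abs norm_power norm_divide)
    show "(\<lambda>k. ?g k t) sums (exp (of_real a * cis t) * cis (- (real n * t)))" for t
    proof -
      have "(\<lambda>k. (of_real a * cis t) ^ k /\<^sub>R fact k * cis (- (real n * t))) sums
          (exp (of_real a * cis t) * cis (- (real n * t)))"
        by (intro sums_mult2 exp_converges)
      moreover have "(of_real a * cis t) ^ k /\<^sub>R fact k * cis (- (real n * t)) = ?g k t" for k
        by (simp add: power_mult_distrib Complex.DeMoivre cis_mult scaleR_conv_of_real field_simps)
      ultimately show ?thesis by simp
    qed
  qed (auto intro!: continuous_intros simp: cis_conv_exp)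
  moreover have "(LINT t:{-pi..pi}|lborel. ?g k t) = (if k = n then of_real (2 * pi * a ^ n / fact n) else 0)" for k
    unfolding set_integral_mult_right integral_cis_period by auto
  ultimately have "(\<lambda>k. if k = n then of_real (2 * pi * a ^ n / fact n) else 0) sums
      (LINT t:{-pi..pi}|lborel. exp (of_real a * cis t) * cis (- (real n * t)))"
    by simp
  then show ?thesis by (rule sums_unique2[OF _ sums_single])
qed

section \<open>A Dobinski formula and the circle integral\<close>

lemma poly_falling_poly: "poly (falling_poly k) x = (\<Prod>i<k. x - real i)"
  by (simp add: falling_poly_def poly_prod)

text \<open>
  These are the factorial moments of the Poisson distribution, up to the factor \<open>exp (- c)\<close>. They
  explain why the falling factorial basis in the definition of the Whitney numbers leads to
  a plain sum over \<open>k\<close>.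
\<close>

lemma falling_exp_sums:
  "(\<lambda>j. (\<Prod>i<k. real j - real i) * c ^ j / fact j) sums (c ^ k * exp (c::real))"
proof (induction k)
  case 0
  then show ?case using exp_converges[of c] by (simp add: field_simps)
next
  case (Suc k)
  let ?f = "\<lambda>j. (\<Prod>i<Suc k. real j - real i) * c ^ j / fact j"
  have "?f (Suc j) = c * ((\<Prod>i<k. real j - real i) * c ^ j / fact j)" for j
  proof -
    have "real (Suc j) * p * c ^ Suc j / fact (Suc j) = c * (p * c ^ j / fact j)" for p
      unfolding fact_Suc by (simp del: of_nat_Suc)
    then show ?thesis unfolding prod.lessThan_Suc_shift by simp
  qed
  then have "(\<lambda>j. ?f (Suc j)) sums (c ^ Suc k * exp c)"
    using sums_mult[OF Suc.IH, of c] by (simp add: mult_ac)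
  moreover have "?f 0 = 0" unfolding prod.lessThan_Suc_shift by simp
  ultimately show ?case using sums_Suc[of ?f "c ^ Suc k * exp c"] by (simp only: add_0_right)
qed

text \<open>
  In \<open>(m j + r)\<^sup>n = \<Sum>k\<le>n. m\<^sup>k W(n,k) (j)\<^sub>k\<close> the \<open>k\<close>-th factorial moment
  for the parameter \<open>1/m\<close> contributes \<open>m\<close> to the power \<open>- k\<close>, which cancels \<open>m\<^sup>k\<close> and leaves the
  sum of the Whitney numbers.
\<close>

lemma r_dowling_dobinski:
  assumes "m > 0"
  shows "(\<lambda>j. (real m * real j + real r) ^ n * (1 / real m) ^ j / fact j) sums
    (exp (1 / real m) * r_dowling m r n)"
proof -
  have "(real m * real j + real r) ^ n =
      (\<Sum>k\<le>n. real m ^ k * r_whitney m r n k * (\<Prod>i<k. real j - real i))" for j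
    using arg_cong[OF r_whitney_identity[OF assms, of r n], of "\<lambda>p. poly p (real j)"]
    by (simp add: poly_sum poly_falling_poly add_ac mult_ac)
  then have "(real m * real j + real r) ^ n * (1 / real m) ^ j / fact j =
     (\<Sum>k\<le>n. real m ^ k * r_whitney m r n k * ((\<Prod>i<k. real j - real i) * (1 / real m) ^ j / fact j))" for j
    by (simp only: sum_distrib_right sum_divide_distrib mult.assoc times_divide_eq_right)
  moreover have "(\<lambda>j. \<Sum>k\<le>n. real m ^ k * r_whitney m r n k * ((\<Prod>i<k. real j - real i) * (1 / real m) ^ j / fact j))
     sums (\<Sum>k\<le>n. real m ^ k * r_whitney m r n k * ((1 / real m) ^ k * exp (1 / real m)))"
    by (intro sums_sum sums_mult falling_exp_sums)
  moreover have "(\<Sum>k\<le>n. real m ^ k * r_whitney m r n k * ((1 / real m) ^ k * exp (1 / real m)))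
      = exp (1 / real m) * r_dowling m r n"
    using assms by (auto simp: r_dowling_def sum_distrib_left power_divide field_simps intro!: sum.cong)
  ultimately show ?thesis by simp
qed

text \<open>
  The integrand is a mixture of the functions \<open>exp ((m j + r) z)\<close> with the Dobinski weights,
  because \<open>exp (exp (m z) / m)\<close> expands in powers of \<open>exp (m z)\<close>. Its \<open>n\<close>-th Fourier
  coefficient is then the Dobinski series.
\<close>

lemma r_dowling_circle_integral:
  fixes \<delta> :: real
  assumes "m > 0"
  shows "(LINT t:{-pi..pi}|lborel.
      exp (of_real (real r * \<delta>) * cis t + (exp (of_real (real m * \<delta>) * cis t) - 1) / of_nat m) * cis (- (real n * t)))
    = of_real (2 * pi * \<delta> ^ n * r_dowling m r n / fact n)"
    (is "?I = _")
proof -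
  define c where "c j = exp (- (1 / real m)) * (1 / real m) ^ j / fact j" for j
  define a where "a j = (real m * real j + real r) * \<delta>" for j
  let ?g = "\<lambda>j t. of_real (c j) * (exp (of_real (a j) * cis t) * cis (- (real n * t)))"
  have c0: "c j \<ge> 0" for j by (simp add: c_def)
  have int: "(\<lambda>j. LINT t:{-pi..pi}|lborel. ?g j t) sums ?I"
  proof (rule set_integral_sums_dominated)
    have e: "c j * exp \<bar>a j\<bar> = exp (- (1 / real m) + real r * \<bar>\<delta>\<bar>) * ((exp (real m * \<bar>\<delta>\<bar>) / real m) ^ j /\<^sub>R fact j)" for j
    proof -
      have "\<bar>a j\<bar> = real r * \<bar>\<delta>\<bar> + real j * (real m * \<bar>\<delta>\<bar>)"
        unfolding a_def abs_mult by (simp add: algebra_simps)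
      then have "exp \<bar>a j\<bar> = exp (real r * \<bar>\<delta>\<bar>) * exp (real m * \<bar>\<delta>\<bar>) ^ j"
        by (simp add: exp_add exp_of_nat_mult)
      moreover have "exp (- (1 / real m) + real r * \<bar>\<delta>\<bar>) = exp (- (1 / real m)) * exp (real r * \<bar>\<delta>\<bar>)"
        by (rule exp_add)
      ultimately show ?thesis by (simp only: c_def power_divide real_scaleR_def) (simp add: divide_inverse)
    qed
    show "summable (\<lambda>j. c j * exp \<bar>a j\<bar>)"
      unfolding e by (intro summable_mult summable_exp_generic)
    show "norm (?g j t) \<le> c j * exp \<bar>a j\<bar>" for j t
    proof -
      have "a j * cos t \<le> \<bar>a j\<bar>"
      proof -
        have "\<bar>a j * cos t\<bar> \<le> \<bar>a j\<bar> * 1"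
          unfolding abs_mult by (intro mult_left_mono abs_cos_le_one) simp
        then show ?thesis by linarith
      qed
      then show ?thesis using c0 by (simp add: norm_mult mult_left_mono)
    qed
    show "(\<lambda>j. ?g j t) sums (exp (of_real (real r * \<delta>) * cis t + (exp (of_real (real m * \<delta>) * cis t) - 1) / of_nat m)
          * cis (- (real n * t)))" for t
    proof -
      let ?z = "of_real (real m * \<delta>) * cis t"
      have "(\<lambda>j. exp (of_real (real r * \<delta>) * cis t - 1 / of_nat m) * ((exp ?z / of_nat m) ^ j /\<^sub>R fact j) * cis (- (real n * t)))
         sums (exp (of_real (real r * \<delta>) * cis t - 1 / of_nat m) * exp (exp ?z / of_nat m) * cis (- (real n * t)))"
        by (intro sums_mult sums_mult2 exp_converges)
      moreover have "exp (of_real (real r * \<delta>) * cis t - 1 / of_nat m) * exp (exp ?z / of_nat m)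
         = exp (of_real (real r * \<delta>) * cis t + (exp ?z - 1) / of_nat m)"
        by (simp add: exp_add[symmetric] diff_divide_distrib add_diff_eq diff_add_eq)
      moreover have "exp (of_real (real r * \<delta>) * cis t - 1 / of_nat m) * ((exp ?z / of_nat m) ^ j /\<^sub>R fact j) * cis (- (real n * t)) = ?g j t" for j
      proof -
        have "exp (of_real (a j) * cis t) = exp (of_real (real r * \<delta>) * cis t) * exp ?z ^ j"
          by (simp add: a_def exp_of_nat_mult[symmetric] exp_add[symmetric] algebra_simps)
        moreover have "of_real (c j) = (exp (- (1 / of_nat m)) * (1 / of_nat m) ^ j / fact j :: complex)"
          by (simp add: c_def exp_of_real[symmetric])
        ultimately show ?thesis
          by (simp add: exp_diff exp_minus power_divide scaleR_conv_of_real field_simps)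
      qed
      ultimately show ?thesis by simp
    qed
  qed (auto intro!: continuous_intros simp: cis_conv_exp)
  moreover have "(LINT t:{-pi..pi}|lborel. ?g j t) = of_real (c j * (2 * pi * a j ^ n / fact n))" for j
    unfolding set_integral_mult_right exp_fourier_coefficient by simp
  moreover have "(\<lambda>j. c j * (2 * pi * a j ^ n / fact n)) sums (2 * pi * \<delta> ^ n * r_dowling m r n / fact n)"
  proof -
    have "(\<lambda>j. exp (- (1 / real m)) * (2 * pi * \<delta> ^ n / fact n) *
        ((real m * real j + real r) ^ n * (1 / real m) ^ j / fact j)) sums
       (exp (- (1 / real m)) * (2 * pi * \<delta> ^ n / fact n) * (exp (1 / real m) * r_dowling m r n))"
      by (intro sums_mult r_dowling_dobinski assms)
    moreover have "exp (- (1 / real m)) * (2 * pi * \<delta> ^ n / fact n) *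
        ((real m * real j + real r) ^ n * (1 / real m) ^ j / fact j) = c j * (2 * pi * a j ^ n / fact n)" for j
      by (simp add: c_def a_def power_mult_distrib mult_ac)
    moreover have "exp (- (1 / real m)) * (2 * pi * \<delta> ^ n / fact n) * (exp (1 / real m) * r_dowling m r n)
        = 2 * pi * \<delta> ^ n * r_dowling m r n / fact n"
      by (simp add: exp_minus field_simps)
    ultimately show ?thesis by (simp only:)
  qed
  ultimately have "(\<lambda>j. of_real (c j * (2 * pi * a j ^ n / fact n))) sums ?I"
    and "(\<lambda>j. of_real (c j * (2 * pi * a j ^ n / fact n)) :: complex) sums
      of_real (2 * pi * \<delta> ^ n * r_dowling m r n / fact n)"
    by (simp_all only: sums_of_real)
  then show ?thesis by (rule sums_unique2)
qed

section \<open>Comparison with a Gaussian\<close>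

lemma has_bochner_integral_gaussian:
  assumes "s > 0"
  shows "has_bochner_integral lborel (\<lambda>t::real. exp (- (s * t\<^sup>2 / 2))) (sqrt (2 * pi / s))"
proof -
  define \<sigma> where "\<sigma> = 1 / sqrt s"
  have \<sigma>: "\<sigma> > 0" "\<sigma>\<^sup>2 = 1 / s" using assms by (auto simp: \<sigma>_def power_divide)
  have "has_bochner_integral lborel (normal_density 0 \<sigma>) 1"
    using \<sigma> by (simp add: has_bochner_integral_iff)
  from has_bochner_integral_mult_right[OF this, of "sqrt (2 * pi / s)"]
  have "has_bochner_integral lborel (\<lambda>t. sqrt (2 * pi / s) * normal_density 0 \<sigma> t) (sqrt (2 * pi / s))"
    by simp
  moreover have "sqrt (2 * pi / s) * normal_density 0 \<sigma> t = exp (- (s * t\<^sup>2 / 2))" for t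
    using assms by (simp add: normal_density_def \<sigma> mult.commute)
  ultimately show ?thesis by simp
qed

lemma has_bochner_integral_gaussian_cubic:
  assumes "c > 0"
  shows "has_bochner_integral lborel (\<lambda>t::real. \<bar>t\<bar> ^ 3 * exp (- (c * t\<^sup>2))) (1 / c\<^sup>2)"
proof -
  define \<sigma> where "\<sigma> = 1 / sqrt (2 * c)"
  have \<sigma>: "\<sigma> > 0" "\<sigma>\<^sup>2 = 1 / (2 * c)" using assms by (auto simp: \<sigma>_def power_divide)
  have "has_bochner_integral lborel (\<lambda>t. sqrt (pi / c) * (normal_density 0 \<sigma> t * \<bar>t\<bar> ^ 3))
      (sqrt (pi / c) * (2 * \<sigma> ^ 3 * sqrt (2 / pi)))"
    using has_bochner_integral_mult_right[OF normal_moment_abs_odd[OF \<sigma>(1), of 0 1], of "sqrt (pi / c)"]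
    by (simp add: eval_nat_numeral)
  moreover have "sqrt (pi / c) * (normal_density 0 \<sigma> t * \<bar>t\<bar> ^ 3) = \<bar>t\<bar> ^ 3 * exp (- (c * t\<^sup>2))" for t
    using assms by (simp add: normal_density_def \<sigma> mult.commute)
  moreover have "sqrt (pi / c) * (2 * \<sigma> ^ 3 * sqrt (2 / pi)) = 1 / c\<^sup>2"
  proof -
    have "sqrt (pi / c) * sqrt (2 / pi) = 2 * \<sigma>"
      using assms by (simp add: \<sigma>_def real_sqrt_divide real_sqrt_mult field_simps)
    then have "sqrt (pi / c) * (2 * \<sigma> ^ 3 * sqrt (2 / pi)) = 4 * (\<sigma>\<^sup>2)\<^sup>2"
      by (simp add: algebra_simps eval_nat_numeral)
    then show ?thesis by (simp add: \<sigma> power_divide power_mult_distrib)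
  qed
  ultimately show ?thesis by simp
qed

text \<open>
  Both integrals are compared over the whole line, with \<open>F\<close> extended by zero. Beyond
  \<open>\<bar>t\<bar> = pi\<close> the difference is just the Gaussian, and the condition \<open>1 \<le> K * pi ^ 3\<close> lets the cubic
  majorant cover it as well, so that the Gaussian tails need no estimate of their own.
\<close>

lemma laplace_comparison:
  fixes F :: "real \<Rightarrow> complex"
  assumes cont: "continuous_on {-pi..pi} F"
    and c: "0 < c" "2 * c \<le> s"
    and K: "1 \<le> K * pi ^ 3"
    and near: "\<And>t. \<bar>t\<bar> \<le> pi \<Longrightarrow> norm (F t - of_real (exp (- (s * t\<^sup>2 / 2)))) \<le> K * \<bar>t\<bar> ^ 3 * exp (- (c * t\<^sup>2))"
  shows "norm ((LINT t:{-pi..pi}|lborel. F t) - of_real (sqrt (2 * pi / s))) \<le> K / c\<^sup>2"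
proof -
  let ?F = "\<lambda>t. indicator {-pi..pi} t *\<^sub>R F t"
  let ?G = "\<lambda>t. exp (- (s * t\<^sup>2 / 2))"
  let ?H = "\<lambda>t. K * (\<bar>t\<bar> ^ 3 * exp (- (c * t\<^sup>2)))"
  have "s > 0" using c by linarith
  have F: "integrable lborel ?F" by (intro borel_integrable_compact compact_Icc cont)
  have G: "has_bochner_integral lborel (\<lambda>t. of_real (?G t)) (of_real (sqrt (2 * pi / s)) :: complex)"
    using has_bochner_integral_gaussian[OF \<open>s > 0\<close>] by (rule has_bochner_integral_of_real)
  have H: "has_bochner_integral lborel ?H (K / c\<^sup>2)"
    using has_bochner_integral_mult_right[OF has_bochner_integral_gaussian_cubic[OF c(1)], of K] by simp
  have le: "norm (?F t - of_real (?G t)) \<le> ?H t" for t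
  proof (cases "\<bar>t\<bar> \<le> pi")
    case True
    then show ?thesis using near[of t] by (simp add: abs_le_iff mult.assoc)
  next
    case False
    have "0 < K" using K by (smt (verit) mult_nonpos_nonneg pi_ge_zero zero_le_power)
    have "1 \<le> K * \<bar>t\<bar> ^ 3"
    proof -
      have "pi ^ 3 \<le> \<bar>t\<bar> ^ 3" using False by (intro power_mono) auto
      then have "K * pi ^ 3 \<le> K * \<bar>t\<bar> ^ 3" using \<open>0 < K\<close> by simp
      then show ?thesis using K by linarith
    qed
    moreover have "?G t \<le> exp (- (c * t\<^sup>2))" using mult_right_mono[OF c(2), of "t\<^sup>2"] by simp
    ultimately have "1 * ?G t \<le> (K * \<bar>t\<bar> ^ 3) * exp (- (c * t\<^sup>2))"
      by (intro mult_mono) auto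
    moreover have "t \<notin> {-pi..pi}" using False by auto
    ultimately show ?thesis by (simp add: mult.assoc norm_minus_commute)
  qed
  have "(LINT t:{-pi..pi}|lborel. F t) - of_real (sqrt (2 * pi / s)) = (\<integral>t. ?F t - of_real (?G t) \<partial>lborel)"
    using F G by (simp add: set_lebesgue_integral_def has_bochner_integral_iff)
  also have "norm \<dots> \<le> (\<integral>t. norm (?F t - of_real (?G t)) \<partial>lborel)" by (rule integral_norm_bound)
  also have "\<dots> \<le> (\<integral>t. ?H t \<partial>lborel)"
    using F G H by (intro integral_mono integrable_norm Bochner_Integration.integrable_diff le) (auto simp: has_bochner_integral_iff)
  also have "\<dots> = K / c\<^sup>2" using H by (simp add: has_bochner_integral_iff)
  finally show ?thesis .
qed

lemma norm_exp_diff_le: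
  fixes u v :: complex
  assumes "Re u \<le> b" "Re v \<le> b"
  shows "norm (exp u - exp v) \<le> exp b * norm (u - v)"
proof (rule field_differentiable_bound[where S = "{z. Re z \<le> b}" and f' = exp])
  show "convex {z. Re z \<le> b}" by (rule convex_halfspace_Re_le)
qed (use assms in \<open>auto intro!: DERIV_exp DERIV_subset[OF DERIV_exp]\<close>)

text \<open>
  From \<open>u cos u \<le> sin u\<close> at \<open>u = y / 2\<close> and the double angle formula,
  \<open>sin y \<ge> y (cos (y / 2))\<^sup>2 = y (1 + cos y) / 2\<close>.
\<close>

lemma sin_ge_half:
  assumes "0 \<le> y" "y \<le> pi / 2"
  shows "y / 2 \<le> sin y"
proof -
  have "0 * cos 0 - sin 0 \<ge> y / 2 * cos (y / 2) - sin (y / 2)"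
  proof (rule DERIV_nonpos_imp_nonincreasing[of 0 "y / 2" "\<lambda>u. u * cos u - sin u"])
    fix u assume u: "0 \<le> u" "u \<le> y / 2"
    have "((\<lambda>u. u * cos u - sin u) has_real_derivative - (u * sin u)) (at u)"
      by (auto intro!: derivative_eq_intros)
    moreover have "0 \<le> u * sin u" using u assms by (intro mult_nonneg_nonneg sin_ge_zero) auto
    ultimately show "\<exists>d. ((\<lambda>u. u * cos u - sin u) has_real_derivative d) (at u) \<and> d \<le> 0" by force
  qed (use assms in auto)
  then have "y / 2 * cos (y / 2) \<le> sin (y / 2)" by simp
  moreover have "0 \<le> cos (y / 2)" using assms by (intro cos_ge_zero) auto
  ultimately have "y / 2 * cos (y / 2) * cos (y / 2) \<le> sin (y / 2) * cos (y / 2)" by (rule mult_right_mono)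
  moreover have "sin y = 2 * (sin (y / 2) * cos (y / 2))" using sin_double[of "y / 2"] by simp
  moreover have "cos (y / 2) * cos (y / 2) = (1 + cos y) / 2"
    using cos_double_cos[of "y / 2"] by (simp add: power2_eq_square)
  moreover have "0 \<le> y * cos y" using assms by (intro mult_nonneg_nonneg cos_ge_zero) auto
  ultimately show ?thesis by (simp add: mult.assoc field_simps)
qed

lemma one_minus_cos_ge:
  assumes "\<bar>t\<bar> \<le> pi"
  shows "t\<^sup>2 / 8 \<le> 1 - cos t"
proof -
  have "(\<bar>t\<bar> / 2 / 2)\<^sup>2 \<le> (sin (\<bar>t\<bar> / 2))\<^sup>2"
    using sin_ge_half[of "\<bar>t\<bar> / 2"] assms by (intro power_mono) auto
  then have "t\<^sup>2 / 16 \<le> (sin (\<bar>t\<bar> / 2))\<^sup>2" by (simp add: power_divide)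
  moreover have "cos t = 1 - 2 * (sin (\<bar>t\<bar> / 2))\<^sup>2"
    using cos_double_sin[of "\<bar>t\<bar> / 2"] by simp
  ultimately show ?thesis by simp
qed

section \<open>The phase on the saddle-point circle\<close>

text \<open>
  With \<open>p = r \<delta>\<close>, \<open>b = 1 / m\<close>, \<open>x = m \<delta>\<close> and \<open>\<nu> = n\<close> this is the logarithm of the
  circle integrand minus its value \<open>g0\<close> at \<open>t = 0\<close>. The saddle-point equation becomes
  \<open>\<nu> = p + b x exp x\<close>.
\<close>
definition phase :: "real \<Rightarrow> real \<Rightarrow> real \<Rightarrow> real \<Rightarrow> real \<Rightarrow> complex" where
  "phase p b x \<nu> t = of_real p * (cis t - 1) + of_real b * (exp (of_real x * cis t) - of_real (exp x)) - \<i> * of_real (\<nu> * t)"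

text \<open>
  Write \<open>u = 1 - cos t\<close>. The linear part contributes \<open>- p u\<close>. The exponential part is controlled by
  \<open>\<bar>exp (x w)\<bar> = exp x exp (- x u)\<close> on \<open>\<bar>w\<bar> = 1\<close>, together with
  \<open>1 - exp (- y) \<ge> y / (1 + y)\<close> and \<open>u \<le> 2\<close>; it contributes at most
  \<open>- b x exp x u / (1 + 2 x)\<close>. Since \<open>p\<close> and \<open>b x exp x\<close> add up to \<open>\<nu>\<close>, the bound is uniform in
  how \<open>\<nu>\<close> splits between the two parts.
\<close>

lemma Re_phase_le:
  assumes "p \<ge> 0" "b > 0" "x > 0" and \<nu>: "\<nu> = p + b * x * exp x" and t: "\<bar>t\<bar> \<le> pi"
  shows "Re (phase p b x \<nu> t) \<le> - (\<nu> / (8 * (1 + 2 * x)) * t\<^sup>2)"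
proof -
  define u where "u = 1 - cos t"
  have u: "0 \<le> u" "u \<le> 2" "t\<^sup>2 / 8 \<le> u" 
    using one_minus_cos_ge[OF t] cos_ge_minus_one[of t] by (auto simp: u_def)
  have "Re (exp (of_real x * cis t)) \<le> exp (x * cos t)"
    using complex_Re_le_cmod[of "exp (of_real x * cis t)"] by simp
  also have "\<dots> = exp x * exp (- (x * u))" by (simp add: exp_add[symmetric] u_def algebra_simps)
  also have "exp (- (x * u)) \<le> 1 / (1 + x * u)"
    using exp_ge_add_one_self[of "x * u"] u assms by (simp add: exp_minus field_simps add_pos_nonneg)
  also have "\<dots> = 1 - x * u / (1 + x * u)"
  proof -
    have "1 + x * u \<noteq> 0" using u assms by (smt (verit) mult_nonneg_nonneg)
    then show ?thesis by (simp add: field_simps)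
  qed
  also have "\<dots> \<le> 1 - x * u / (1 + 2 * x)"
    using u assms by (intro diff_left_mono divide_left_mono) (auto simp: add_pos_nonneg mult.commute)
  finally have 1: "Re (exp (of_real x * cis t)) \<le> exp x * (1 - x * u / (1 + 2 * x))"
    by simp
  have "Re (phase p b x \<nu> t) = - (p * u) + b * (Re (exp (of_real x * cis t)) - exp x)"
    by (simp add: phase_def u_def algebra_simps)
  also have "\<dots> \<le> - (p * u) + b * (exp x * (1 - x * u / (1 + 2 * x)) - exp x)"
    using 1 assms by (intro add_left_mono mult_left_mono) auto
  also have "\<dots> = - (p * u) - b * x * exp x * u / (1 + 2 * x)"
    by (simp add: algebra_simps)
  also have "\<dots> \<le> - (p * u / (1 + 2 * x)) - b * x * exp x * u / (1 + 2 * x)"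
  proof -
    have "p * u / (1 + 2 * x) \<le> p * u / 1"
      using u assms by (intro divide_left_mono mult_nonneg_nonneg) auto
    then show ?thesis by simp
  qed
  also have "\<dots> = - (\<nu> / (1 + 2 * x) * u)"
    by (simp add: \<nu> add_divide_distrib distrib_right)
  also have "\<dots> \<le> - (\<nu> / (1 + 2 * x) * (t\<^sup>2 / 8))"
    using u assms by (intro le_imp_neg_le mult_left_mono) auto
  finally show ?thesis by simp
qed

text \<open>
  The saddle-point equation removes the linear term. The third derivative is a combination of
  \<open>w = cis t\<close> and the products \<open>w\<^sup>i exp (x w)\<close> with nonnegative coefficients up to a unit factor, so on the circle
  it is largest at \<open>t = 0\<close>, where its modulus is \<open>p + b (x + 3 x\<^sup>2 + x\<^sup>3) exp x\<close>. The
  denominator is \<open>2\<close> rather than \<open>6\<close> because the remainder term in \<open>complex_Taylor\<close> has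
  \<open>fact n\<close> in place of \<open>fact (n + 1)\<close>.
\<close>

lemma phase_taylor:
  assumes "p \<ge> 0" "b > 0" "x > 0" and \<nu>: "\<nu> = p + b * x * exp x"
  shows "norm (phase p b x \<nu> t + of_real ((\<nu> + b * x\<^sup>2 * exp x) * t\<^sup>2 / 2)) \<le> \<nu> * (1 + 3 * x + x\<^sup>2) / 2 * \<bar>t\<bar> ^ 3"
proof -
  define W where "W z = exp (\<i> * z)" for z
  define E where "E z = exp (of_real x * W z)" for z
  \<comment> \<open>The phase and its first three derivatives, extended to complex \<open>z\<close> with \<open>W z\<close> for \<open>cis t\<close>.\<close>
  define f where "f i z = (
     if i = 0 then of_real p * (W z - 1) + of_real b * (E z - of_real (exp x)) - \<i> * of_real \<nu> * z
     else if i = 1 then \<i> * (of_real p * W z + of_real (b * x) * W z * E z - of_real \<nu>)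
     else if i = 2 then - (of_real p * W z + of_real b * (of_real x * W z + of_real (x^2) * W z ^ 2) * E z)
     else - \<i> * (of_real p * W z + of_real b * (of_real x * W z + 3 * of_real (x^2) * W z ^ 2 + of_real (x^3) * W z ^ 3) * E z))" for i :: nat and z
  have dW[derivative_intros]: "(W has_field_derivative \<i> * W z) (at z within S)" for z S
    unfolding W_def by (auto intro!: derivative_eq_intros)
  have dE[derivative_intros]: "(E has_field_derivative \<i> * of_real x * W z * E z) (at z within S)" for z S
    unfolding E_def by (auto intro!: derivative_eq_intros simp: dW)
  have "cmod (f 0 (of_real t) - (\<Sum>i\<le>2. f i 0 * (of_real t - 0) ^ i / fact i)) \<le> \<nu> * (1 + 3 * x + x\<^sup>2) * cmod (of_real t - 0) ^ Suc 2 / fact 2"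
  proof (rule complex_Taylor[where S = "\<real>"])
    show "convex (\<real> :: complex set)" by (simp add: convex_Reals)
    show "(f i has_field_derivative f (Suc i) z) (at z within \<real>)" if "i \<le> 2" for i z
    proof -
      consider "i = 0" | "i = 1" | "i = 2" using \<open>i \<le> 2\<close> by linarith
      then show ?thesis
      proof cases
        case 1
        then show ?thesis unfolding f_def
          by (auto intro!: derivative_eq_intros simp: algebra_simps)
      next
        case 2
        then show ?thesis unfolding f_def
          by (auto intro!: derivative_eq_intros simp: algebra_simps power2_eq_square)
      next
        case 3
        then show ?thesis unfolding f_def
          by (auto intro!: derivative_eq_intros simp: algebra_simps power2_eq_square power3_eq_cube)
      qed
    qed
    show "cmod (f (Suc 2) z) \<le> \<nu> * (1 + 3 * x + x\<^sup>2)" if "z \<in> \<real>" for z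
    proof -
      from that obtain y where z: "z = of_real y" by (rule Reals_cases)
      have W: "cmod (W z) = 1" by (simp add: W_def z)
      then have "Re (W z) \<le> 1" by (metis complex_Re_le_cmod)
      then have E: "cmod (E z) \<le> exp x" using assms by (simp add: E_def)
      let ?q = "of_real x * W z + 3 * of_real (x^2) * W z ^ 2 + of_real (x^3) * W z ^ 3"
      have "cmod ?q \<le> x + 3 * x^2 + x^3"
        by (intro norm_triangle_le add_mono) (use assms W in \<open>auto simp: norm_mult norm_power\<close>)
      then have "cmod ?q * cmod (E z) \<le> (x + 3 * x^2 + x^3) * exp x"
        using E assms by (intro mult_mono) auto
      then have "b * (cmod ?q * cmod (E z)) \<le> b * ((x + 3 * x^2 + x^3) * exp x)"
        using assms by (intro mult_left_mono) auto
      moreover have "cmod (f (Suc 2) z) \<le> p * 1 + b * (cmod ?q * cmod (E z))"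
      proof -
        have "cmod (f (Suc 2) z) = cmod (of_real p * W z + of_real b * ?q * E z)"
          by (simp add: f_def norm_mult del: of_real_power)
        also have "\<dots> \<le> cmod (of_real p * W z) + cmod (of_real b * ?q * E z)"
          by (rule norm_triangle_ineq)
        finally show ?thesis using assms W by (simp add: norm_mult mult.assoc del: of_real_power)
      qed
      ultimately have "cmod (f (Suc 2) z) \<le> p + b * ((x + 3 * x^2 + x^3) * exp x)" by linarith
      also have "\<dots> \<le> p * (1 + 3 * x + x^2) + b * ((x + 3 * x^2 + x^3) * exp x)"
        using assms by (simp add: algebra_simps)
      also have "\<dots> = \<nu> * (1 + 3 * x + x\<^sup>2)"
        by (simp add: \<nu> algebra_simps eval_nat_numeral)
      finally show ?thesis .
    qed
  qed auto
  moreover have "f 0 (of_real t) = phase p b x \<nu> t"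
    by (simp add: f_def phase_def W_def E_def cis_conv_exp mult_ac)
  moreover have "(\<Sum>i\<le>2. f i 0 * (of_real t - 0) ^ i / fact i) = - of_real ((\<nu> + b * x\<^sup>2 * exp x) * t\<^sup>2 / 2)"
    by (simp add: f_def W_def E_def exp_of_real \<nu> eval_nat_numeral algebra_simps)
  ultimately show ?thesis by (simp add: eval_nat_numeral mult_ac)
qed

text \<open>
  Both \<open>exp (\<phi> t)\<close> and the Gaussian are at most \<open>exp (- c t\<^sup>2)\<close> in modulus, so their difference
  is at most this factor times the difference of the exponents. The hypothesis \<open>\<nu> \<ge> 1\<close> makes \<open>K\<close> at
  least \<open>1 / 2\<close>, which is what the comparison needs beyond \<open>\<bar>t\<bar> = pi\<close>.
\<close>

lemma phase_integral:
  assumes "p \<ge> 0" "b > 0" "x > 0" and \<nu>: "\<nu> = p + b * x * exp x" "\<nu> \<ge> 1"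
  shows "norm ((LINT t:{-pi..pi}|lborel. exp (phase p b x \<nu> t)) - of_real (sqrt (2 * pi / (\<nu> + b * x\<^sup>2 * exp x))))
    \<le> 32 * (1 + 3 * x + x\<^sup>2) * (1 + 2 * x)\<^sup>2 / \<nu>"
proof -
  define s where "s = \<nu> + b * x\<^sup>2 * exp x"
  define c where "c = \<nu> / (8 * (1 + 2 * x))"
  define K where "K = \<nu> * (1 + 3 * x + x\<^sup>2) / 2"
  have c: "0 < c" using assms by (simp add: c_def)
  have "2 * c \<le> \<nu>" using assms by (simp add: c_def field_simps)
  also have "\<nu> \<le> s" using assms by (simp add: s_def)
  finally have cs: "2 * c \<le> s" .
  have "1 * 1 \<le> \<nu> * (1 + 3 * x + x\<^sup>2)" using assms by (intro mult_mono) auto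
  then have "1 / 2 \<le> K" by (simp add: K_def)
  moreover have "3 ^ 3 \<le> pi ^ 3" using pi_gt3 by (intro power_mono) auto
  ultimately have "1 / 2 * 3 ^ 3 \<le> K * pi ^ 3" by (intro mult_mono) auto
  then have K: "1 \<le> K * pi ^ 3" by simp
  have "norm ((LINT t:{-pi..pi}|lborel. exp (phase p b x \<nu> t)) - of_real (sqrt (2 * pi / s))) \<le> K / c\<^sup>2"
  proof (rule laplace_comparison[OF _ c cs K])
    show "continuous_on {-pi..pi} (\<lambda>t. exp (phase p b x \<nu> t))"
      unfolding phase_def cis_conv_exp by (intro continuous_intros)
    fix t :: real assume t: "\<bar>t\<bar> \<le> pi"
    have "norm (exp (phase p b x \<nu> t) - exp (of_real (- (s * t\<^sup>2 / 2))))
        \<le> exp (- (c * t\<^sup>2)) * norm (phase p b x \<nu> t - of_real (- (s * t\<^sup>2 / 2)))"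
    proof (rule norm_exp_diff_le)
      show "Re (phase p b x \<nu> t) \<le> - (c * t\<^sup>2)"
        unfolding c_def by (rule Re_phase_le) (use assms t in auto)
      show "Re (of_real (- (s * t\<^sup>2 / 2))) \<le> - (c * t\<^sup>2)"
        using mult_right_mono[OF cs, of "t\<^sup>2"] by simp
    qed
    also have "\<dots> \<le> exp (- (c * t\<^sup>2)) * (K * \<bar>t\<bar> ^ 3)"
      using phase_taylor[of p b x \<nu> t] assms by (intro mult_left_mono) (auto simp: s_def K_def)
    finally show "norm (exp (phase p b x \<nu> t) - of_real (exp (- (s * t\<^sup>2 / 2)))) \<le> K * \<bar>t\<bar> ^ 3 * exp (- (c * t\<^sup>2))"
      by (simp add: exp_of_real[symmetric] mult_ac)
  qed
  also have "K / c\<^sup>2 = 32 * (1 + 3 * x + x\<^sup>2) * (1 + 2 * x)\<^sup>2 / \<nu>"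
  proof -
    have "K / c\<^sup>2 = \<nu> * (1 + 3 * x + x\<^sup>2) * (64 * (1 + 2 * x)\<^sup>2) / (2 * \<nu>\<^sup>2)"
    proof -
      have "c\<^sup>2 = \<nu>\<^sup>2 / (64 * (1 + 2 * x)\<^sup>2)"
        unfolding c_def power_divide power_mult_distrib by simp
      then show ?thesis by (simp only: K_def) simp
    qed
    then show ?thesis using assms(5) by (simp add: power2_eq_square[of \<nu>])
  qed
  finally show ?thesis by (simp add: s_def)
qed

section \<open>The asymptotic formula\<close>

text \<open>
  The circle integral divided by \<open>exp g0\<close> is the integral of \<open>exp\<close> of the phase, so the comparison
  with a Gaussian becomes an explicit inequality for \<open>D(n)\<close>.
\<close>

lemma r_dowling_saddle_point:
  fixes \<delta> :: real
  assumes "m > 0" "n > 0" "\<delta> > 0" and saddle: "\<delta> * (real r + exp (real m * \<delta>)) = real n"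
  defines "g0 \<equiv> real r * \<delta> + (exp (real m * \<delta>) - 1) / real m"
    and "s \<equiv> real n + real m * \<delta>\<^sup>2 * exp (real m * \<delta>)"
    and "x \<equiv> real m * \<delta>"
  shows "\<bar>2 * pi * \<delta> ^ n * r_dowling m r n / (exp g0 * fact n) - sqrt (2 * pi / s)\<bar>
    \<le> 32 * (1 + 3 * x + x\<^sup>2) * (1 + 2 * x)\<^sup>2 / real n"
proof -
  let ?p = "real r * \<delta>" and ?b = "1 / real m"
  let ?V = "2 * pi * \<delta> ^ n * r_dowling m r n / (exp g0 * fact n)"
  have \<nu>: "real n = ?p + ?b * x * exp x"
    using assms(1) by (simp add: saddle[symmetric] x_def algebra_simps)
  have s: "s = real n + ?b * x\<^sup>2 * exp x"
    using assms(1) by (simp add: s_def x_def power2_eq_square)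
  have "exp (phase ?p ?b x (real n) t) = of_real (exp (- g0)) *
      (exp (of_real (real r * \<delta>) * cis t + (exp (of_real (real m * \<delta>) * cis t) - 1) / of_nat m) * cis (- (real n * t)))" for t
  proof -
    have "phase ?p ?b x (real n) t = of_real (- g0) +
      ((of_real (real r * \<delta>) * cis t + (exp (of_real (real m * \<delta>) * cis t) - 1) / of_nat m) + \<i> * of_real (- (real n * t)))"
      by (simp add: phase_def g0_def x_def algebra_simps diff_divide_distrib exp_of_real)
    then show ?thesis by (simp only: exp_add cis_conv_exp exp_of_real)
  qed
  then have "(LINT t:{-pi..pi}|lborel. exp (phase ?p ?b x (real n) t)) =
      of_real (exp (- g0)) * of_real (2 * pi * \<delta> ^ n * r_dowling m r n / fact n)"
    by (simp only: set_integral_mult_right r_dowling_circle_integral[OF assms(1)])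
  also have "\<dots> = of_real ?V" by (simp add: exp_minus divide_inverse mult_ac)
  finally have "norm (of_real ?V - of_real (sqrt (2 * pi / s)) :: complex)
      \<le> 32 * (1 + 3 * x + x\<^sup>2) * (1 + 2 * x)\<^sup>2 / real n"
    using phase_integral[of ?p ?b x "real n"] \<nu> assms(1-3) unfolding s by (simp add: x_def)
  then show ?thesis by (simp only: of_real_diff[symmetric] norm_of_real)
qed

text \<open>
  If \<open>\<delta> \<le> 1\<close>, then \<open>m \<delta> \<le> m < ln n\<close>; otherwise the saddle-point equation itself gives
  \<open>exp (m \<delta>) \<le> n\<close>.
\<close>

lemma saddle_point_le_ln:
  fixes \<delta> :: real
  assumes "real n > exp (real m)" "\<delta> > 0" and saddle: "\<delta> * (real r + exp (real m * \<delta>)) = real n"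
  shows "real m * \<delta> \<le> ln (real n)"
proof -
  have n: "0 < real n" using assms(1) exp_gt_zero less_trans by blast
  show ?thesis
  proof (cases "\<delta> \<le> 1")
    case True
    then have "real m * \<delta> \<le> real m * 1" by (intro mult_left_mono) auto
    also have "real m * 1 \<le> ln (real n)" using n assms(1) by (simp add: ln_ge_iff)
    finally show ?thesis .
  next
    case False
    have "1 * exp (real m * \<delta>) \<le> \<delta> * (real r + exp (real m * \<delta>))"
      using False by (intro mult_mono) auto
    then show ?thesis using n by (simp add: saddle ln_ge_iff)
  qed
qed

theorem theorem5:
  "\<exists>C::real. \<forall>(m::nat) (n::nat) (r::nat) (\<delta>::real) (g0::real) (g2::real).
     m > 0 \<longrightarrow> n > 0 \<longrightarrow> r > 0 \<longrightarrow> real n > exp (real m) \<longrightarrow>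
     \<delta> > 0 \<longrightarrow> \<delta> * (real r + exp (real m * \<delta>)) = real n \<longrightarrow>
     g0 = real r * \<delta> + (exp (real m * \<delta>) - 1) / real m \<longrightarrow>
     g2 = (real n + real m * \<delta>\<^sup>2 * exp (real m * \<delta>)) / 2 \<longrightarrow>
     (\<exists>\<epsilon>::real.
        r_dowling m r n = exp g0 / sqrt (4 * pi * g2) * (fact n / \<delta> ^ n) * (1 + \<epsilon>) \<and>
        \<bar>\<epsilon>\<bar> \<le> C * (ln (real n) ^ 12 / sqrt (real n)))"
proof (rule exI[of _ 1440], intro allI impI)
  fix m n r :: nat and \<delta> g0 g2 :: real
  assume m: "m > 0" and n: "n > 0" and "r > 0" and large: "real n > exp (real m)" and \<delta>: "\<delta> > 0"
    and saddle: "\<delta> * (real r + exp (real m * \<delta>)) = real n"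
    and g0: "g0 = real r * \<delta> + (exp (real m * \<delta>) - 1) / real m"
    and g2: "g2 = (real n + real m * \<delta>\<^sup>2 * exp (real m * \<delta>)) / 2"
  define x where "x = real m * \<delta>"
  define L where "L = ln (real n)"
  define V where "V = 2 * pi * \<delta> ^ n * r_dowling m r n / (exp g0 * fact n)"
  \<comment> \<open>\<open>1 / \<sigma>\<close> is the Gaussian integral \<open>sqrt (2 * pi / (2 * g2))\<close>, so \<open>V * \<sigma>\<close> is the ratio of \<open>D(n)\<close> to the main term.\<close>
  define \<sigma> where "\<sigma> = sqrt (g2 / pi)"
  define \<epsilon> where "\<epsilon> = V * \<sigma> - 1"
  have x: "0 < x" "x \<le> L"
    using m \<delta> saddle_point_le_ln[OF large \<delta> saddle] by (auto simp: x_def L_def)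
  have "real m \<le> L" using n large unfolding L_def by (simp add: ln_ge_iff)
  then have L: "1 \<le> L" using m by simp
  have g2_pos: "g2 > 0" using n m \<delta> by (simp add: g2 add_pos_pos)
  then have \<sigma>_pos: "\<sigma> > 0" by (simp add: \<sigma>_def)
  have V: "\<bar>V - 1 / \<sigma>\<bar> \<le> 32 * (1 + 3 * x + x\<^sup>2) * (1 + 2 * x)\<^sup>2 / real n"
    using r_dowling_saddle_point[OF m n \<delta> saddle]
    by (simp add: V_def \<sigma>_def g0 g2 x_def real_sqrt_divide)

  have "r_dowling m r n = exp g0 / sqrt (4 * pi * g2) * (fact n / \<delta> ^ n) * (1 + \<epsilon>)"
  proof -
    have "sqrt (4 * pi * g2) = 2 * pi * \<sigma>"
    proof -
      have "4 * pi * g2 = (2 * pi)\<^sup>2 * (g2 / pi)" by (simp add: power2_eq_square)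
      then show ?thesis by (simp only: \<sigma>_def real_sqrt_mult real_sqrt_abs) simp
    qed
    then have "exp g0 / sqrt (4 * pi * g2) * (fact n / \<delta> ^ n) * (1 + \<epsilon>)
       = exp g0 / (2 * pi) * (fact n / \<delta> ^ n) * V"
      using \<sigma>_pos by (simp add: \<epsilon>_def)
    also have "\<dots> = r_dowling m r n" using \<delta> by (simp add: V_def)
    finally show ?thesis by simp
  qed
  moreover have "\<bar>\<epsilon>\<bar> \<le> 1440 * (ln (real n) ^ 12 / sqrt (real n))"
  proof -
    have "x\<^sup>2 \<le> L\<^sup>2" using x by (intro power_mono) auto
    moreover have "L \<le> L\<^sup>2" using L by (simp add: power2_eq_square)
    ultimately have "1 + 3 * x + x\<^sup>2 \<le> 5 * L\<^sup>2"
      using x L by linarith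
    moreover have "(1 + 2 * x)\<^sup>2 \<le> (3 * L)\<^sup>2" using x L by (intro power_mono) auto
    ultimately have "(1 + 3 * x + x\<^sup>2) * (1 + 2 * x)\<^sup>2 \<le> (5 * L\<^sup>2) * (3 * L)\<^sup>2"
      using x by (intro mult_mono) auto
    then have num: "32 * (1 + 3 * x + x\<^sup>2) * (1 + 2 * x)\<^sup>2 \<le> 1440 * L ^ 4"
    proof -
      have "(5 * L\<^sup>2) * (3 * L)\<^sup>2 = 45 * L ^ 4"
        by (simp add: power_mult_distrib flip: power_add)
      with \<open>_ \<le> (5 * L\<^sup>2) * (3 * L)\<^sup>2\<close> show ?thesis by linarith
    qed
    have "real m * \<delta>\<^sup>2 * exp (real m * \<delta>) = x * (\<delta> * exp (real m * \<delta>))"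
      by (simp add: x_def power2_eq_square)
    also have "\<dots> \<le> L * real n"
      using x \<delta> saddle[symmetric] by (intro mult_mono) (auto simp: distrib_left)
    finally have "2 * g2 \<le> real n * 1 + real n * L" by (simp add: g2 mult.commute)
    also have "\<dots> \<le> 2 * (real n * L)" using mult_left_mono[OF L, of "real n"] by linarith
    finally have "g2 \<le> real n * L" by simp
    also have "\<dots> \<le> real n * L\<^sup>2" using L by (intro mult_left_mono) (auto simp: power2_eq_square)
    finally have "g2 \<le> real n * L\<^sup>2" .
    moreover have "g2 / pi \<le> g2 / 1"
      using g2_pos pi_gt3 by (intro divide_left_mono) auto
    ultimately have "\<sigma> \<le> sqrt (real n * L\<^sup>2)" unfolding \<sigma>_def by (intro real_sqrt_le_mono) simp
    then have \<sigma>_le: "\<sigma> \<le> sqrt (real n) * L" using L by (simp add: real_sqrt_mult)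
    have "\<bar>\<epsilon>\<bar> = \<bar>V - 1 / \<sigma>\<bar> * \<sigma>"
      using \<sigma>_pos by (simp add: \<epsilon>_def abs_mult_pos left_diff_distrib)
    also have "\<dots> \<le> (1440 * L ^ 4 / real n) * (sqrt (real n) * L)"
      using V divide_right_mono[OF num, of "real n"] \<sigma>_le \<sigma>_pos by (intro mult_mono) auto
    also have "\<dots> = 1440 * (L ^ 5 / sqrt (real n))"
    proof -
      have "sqrt (real n) / real n = 1 / sqrt (real n)"
        using n by (simp add: field_simps)
      moreover have "(1440 * L ^ 4 / real n) * (sqrt (real n) * L) = 1440 * L ^ 5 * (sqrt (real n) / real n)"
        by (simp add: eval_nat_numeral)
      ultimately show ?thesis by simp
    qed
    also have "\<dots> \<le> 1440 * (L ^ 12 / sqrt (real n))"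
      using L by (intro mult_left_mono divide_right_mono power_increasing) auto
    finally show ?thesis by (simp add: L_def)
  qed
  ultimately show "\<exists>\<epsilon>::real.
        r_dowling m r n = exp g0 / sqrt (4 * pi * g2) * (fact n / \<delta> ^ n) * (1 + \<epsilon>) \<and>
        \<bar>\<epsilon>\<bar> \<le> 1440 * (ln (real n) ^ 12 / sqrt (real n))" by blast
qed

end
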